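(* Suppose that the sublevel set $\mathcal K_0=\{z\in\mathbb R^{n+1}:\Phi_{\tau_0}(z)\le\Phi_{\tau_0}(z_0)\}$ is compact, where $z_0$ is the starting point of the continuation, that every $f_i$ is continuously differentiable, and that the idealized continuation uses $\tau_k=\tau_0\tau_{\rm fac}^{\,k}$, $k=0,1,2,\dots$, with $\tau_0>0$ and $0<\tau_{\rm fac}<1$. Let $z_k$ be a terminal point of layer $k$ with $\|\nabla\Phi_{\tau_k}(z_k)\|\le\varepsilon_k$, where $\varepsilon_k\downarrow0$. If the terminal points have an accumulation point $(x^*,t^* )$, then $$0\in\partial f(x^* ).$$
   Context: Let $f_1,\dots,f_m:\mathbb R^n\to\mathbb R$ and $f(x)=\max_{1\le i\le m}f_i(x)$. For $\tau>0$ put $\phi_\tau(r)=\frac{r+\sqrt{r^2+\tau^2}}{2}$ and $\Phi_\tau(x,t)=t+\sum_{i=1}^m\phi_\tau(f_i(x)-t)$, $(x,t)\in\mathbb R^n\times\mathbb R$. $\partial$ denotes the Clarke subdifferential; for continuously differentiable $f_i$, $\partial f(x)$ is the convex hull of $\{\nabla f_i(x):f_i(x)=f(x)\}$. Idealized continuation: start from $z_0=(x_0,f(x_0))$. For each $k=0,1,2,\dots$ (infinitely many layers), layer $k$ is an inner iteration (a preconditioned limited-memory BFGS method with Armijo backtracking, in any of its three negative-curvature-correction variants) applied to $\Phi_{\tau_k}$, started from the last point of the previous layer, and stopped at a terminal point $z_k\in\mathbb R^{n+1}$ satisfying $\|\nabla\Phi_{\tau_k}(z_k)\|\le\varepsilon_k$.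 The stopping test is the only property required of the terminal points, so $(z_k)$ may be read as any sequence of points with $\|\nabla\Phi_{\tau_k}(z_k)\|\le\varepsilon_k$ for all $k$. (Here $z_0$ in the definition of $\mathcal K_0$ is the starting point, not the terminal point of layer $0$.) *)

theory Defs
  imports "HOL-Analysis.Analysis"
begin

definition gradient :: "('a::euclidean_space \<Rightarrow> real) \<Rightarrow> 'a \<Rightarrow> 'a"
  where "gradient f x = (THE D. GDERIV f x :> D)"

definition cont_differentiable :: "('a::euclidean_space \<Rightarrow> real) \<Rightarrow> bool"
  where "cont_differentiable f \<longleftrightarrow>
    (\<forall>x. f differentiable (at x)) \<and> continuous_on UNIV (gradient f)"

(* Clarke's generalized directional derivative
   limsup of (f (y + s d) - f y) / s as y tends to x and s decreases to 0,
   where y = x is allowed.  It is extended-real valued so that it is meaningful for every f;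
   it is finite when f is Lipschitz near x. *)
definition clarke_dir_deriv :: "('a::euclidean_space \<Rightarrow> real) \<Rightarrow> 'a \<Rightarrow> 'a \<Rightarrow> ereal"
  where "clarke_dir_deriv f x d =
    Limsup (nhds x \<times>\<^sub>F at_right (0::real))
      (\<lambda>(y, s). ereal ((f (y + s *\<^sub>R d) - f y) / s))"

definition clarke_subdifferential :: "('a::euclidean_space \<Rightarrow> real) \<Rightarrow> 'a \<Rightarrow> 'a set"
  where "clarke_subdifferential f x =
    {v. \<forall>d. ereal (v \<bullet> d) \<le> clarke_dir_deriv f x d}"

definition max_fun :: "nat \<Rightarrow> (nat \<Rightarrow> 'a \<Rightarrow> real) \<Rightarrow> 'a \<Rightarrow> real"
  where "max_fun m f x = Max ((\<lambda>i. f i x) ` {1..m})"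

definition phi :: "real \<Rightarrow> real \<Rightarrow> real"
  where "phi \<tau> r = (r + sqrt (r\<^sup>2 + \<tau>\<^sup>2)) / 2"

definition Phi :: "nat \<Rightarrow> (nat \<Rightarrow> 'a \<Rightarrow> real) \<Rightarrow> real \<Rightarrow> 'a \<times> real \<Rightarrow> real"
  where "Phi m f \<tau> = (\<lambda>(x, t). t + (\<Sum>i = 1..m. phi \<tau> (f i x - t)))"

end

theory Submission
  imports Defs
begin

text \<open>
  With the weights \<open>w\<^sub>i = \<phi>'\<^sub>\<tau>(f\<^sub>i x - t) \<in> [0, 1]\<close>, the gradient of \<open>\<Phi>\<^sub>\<tau>\<close> at \<open>(x, t)\<close> is
  \<open>(\<Sum>\<^sub>i w\<^sub>i \<nabla>f\<^sub>i x, 1 - \<Sum>\<^sub>i w\<^sub>i)\<close>, so along a convergent subsequence of terminal points the weights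
  sum to 1 in the limit and \<open>\<Sum>\<^sub>i w\<^sub>i \<nabla>f\<^sub>i x'\<close> tends to 0. The weight of an index \<open>j\<close> that is inactive
  at \<open>x'\<close> vanishes in the limit: either \<open>f\<^sub>j x' < t'\<close>, or an active index lies strictly above \<open>t'\<close>
  and absorbs the whole unit mass. Hence for every direction \<open>d\<close> some active gradient has
  nonnegative inner product with \<open>d\<close>, and the one-sided derivative of that active \<open>f\<^sub>i\<close> at \<open>x'\<close>
  is a lower bound for the Clarke derivative of the maximum.
\<close>

section \<open>The smoothing function and its derivative\<close>

definition dphi :: "real \<Rightarrow> real \<Rightarrow> real"
  where "dphi \<tau> r = (1 + r / sqrt (r\<^sup>2 + \<tau>\<^sup>2)) / 2"

lemma phi_has_derivative:
  assumes "\<tau> > 0"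
  shows "(phi \<tau> has_real_derivative dphi \<tau> r) (at r)"
proof -
  have pos: "0 < r\<^sup>2 + \<tau>\<^sup>2"
    using assms by (simp add: add_nonneg_pos)
  have "((\<lambda>r. r\<^sup>2 + \<tau>\<^sup>2) has_real_derivative 2 * r) (at r)"
    by (auto intro!: derivative_eq_intros)
  then have "((\<lambda>r. sqrt (r\<^sup>2 + \<tau>\<^sup>2)) has_real_derivative
      inverse (sqrt (r\<^sup>2 + \<tau>\<^sup>2)) / 2 * (2 * r)) (at r)"
    by (rule DERIV_chain2[where f = sqrt, rotated]) (rule DERIV_real_sqrt[OF pos])
  moreover have "inverse s / 2 * (2 * r) = r / s" for s :: real
    by (simp add: field_simps)
  ultimately have "((\<lambda>r. sqrt (r\<^sup>2 + \<tau>\<^sup>2)) has_real_derivative r / sqrt (r\<^sup>2 + \<tau>\<^sup>2)) (at r)"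
    by simp
  then have "((\<lambda>r. (r + sqrt (r\<^sup>2 + \<tau>\<^sup>2)) / 2) has_real_derivative dphi \<tau> r) (at r)"
    unfolding dphi_def by (intro DERIV_cdivide DERIV_add DERIV_ident)
  then show ?thesis
    by (simp add: phi_def[abs_def])
qed

lemma dphi_bounds:
  shows "0 \<le> dphi \<tau> r" and "dphi \<tau> r \<le> 1"
proof -
  have "\<bar>r\<bar> \<le> sqrt (r\<^sup>2 + \<tau>\<^sup>2)"
    by (rule real_le_rsqrt) simp
  \<comment> \<open>If the root vanishes, the quotient is 0 by the convention on division, so
    \<open>r = \<tau> = 0\<close> is covered as well.\<close>
  then have "\<bar>r / sqrt (r\<^sup>2 + \<tau>\<^sup>2)\<bar> \<le> 1"
    using divide_right_mono[of "\<bar>r\<bar>" "sqrt (r\<^sup>2 + \<tau>\<^sup>2)" "sqrt (r\<^sup>2 + \<tau>\<^sup>2)"]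
      divide_self_if[of "sqrt (r\<^sup>2 + \<tau>\<^sup>2)"]
    by (simp add: abs_divide split: if_splits)
  moreover have "2 * dphi \<tau> r - 1 = r / sqrt (r\<^sup>2 + \<tau>\<^sup>2)"
    by (simp add: dphi_def add_divide_distrib)
  ultimately have "\<bar>2 * dphi \<tau> r - 1\<bar> \<le> 1"
    by (simp only:)
  then show "0 \<le> dphi \<tau> r" and "dphi \<tau> r \<le> 1"
    by linarith+
qed

text \<open>Away from the kink the weights turn into a step function: the limit is 0 for negative
  \<open>R\<close> and 1 for positive \<open>R\<close>. At \<open>R = 0\<close> the relative speed
  of \<open>r\<close> and \<open>\<tau>\<close> would decide, so that case is excluded.\<close>

lemma dphi_tendsto:
  assumes "r \<longlonglongrightarrow> R" "\<tau> \<longlonglongrightarrow> 0" "R \<noteq> 0"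
  shows "(\<lambda>k. dphi (\<tau> k) (r k)) \<longlonglongrightarrow> (1 + sgn R) / 2"
proof -
  have "(\<lambda>k. (1 + r k / sqrt ((r k)\<^sup>2 + (\<tau> k)\<^sup>2)) / 2) \<longlonglongrightarrow> (1 + R / sqrt (R\<^sup>2 + 0\<^sup>2)) / 2"
    using assms by (intro tendsto_intros) auto
  moreover have "R / sqrt (R\<^sup>2 + 0\<^sup>2) = sgn R"
    by (simp add: sgn_div_norm divide_inverse mult.commute)
  ultimately show ?thesis
    by (simp add: dphi_def)
qed

section \<open>Gradients, and the gradient of the smoothed objective\<close>

lemma gradient_eq:
  assumes "GDERIV f x :> D"
  shows "gradient f x = D"
  unfolding gradient_def
proof (rule the_equality)
  show "GDERIV f x :> D"
    by (fact assms)
next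
  fix E assume "GDERIV f x :> E"
  then have "(\<lambda>h. h \<bullet> E) = (\<lambda>h. h \<bullet> D)"
    using assms has_derivative_unique unfolding gderiv_def by blast
  then have "\<forall>h. h \<bullet> E = h \<bullet> D"
    by (auto dest: fun_cong)
  then show "E = D"
    by (simp only: vector_eq_ldot)
qed

lemma differentiable_GDERIV_gradient:
  fixes f :: "'a::euclidean_space \<Rightarrow> real"
  assumes "f differentiable (at x)"
  shows "GDERIV f x :> gradient f x"
proof -
  obtain f' where f': "(f has_derivative f') (at x)"
    using assms by (auto simp: differentiable_def)
  then have "linear f'"
    by (rule has_derivative_linear)
  \<comment> \<open>The Riesz vector of the functional \<open>f'\<close> is its adjoint applied to
    1, because \<open>f' h\<close> is the inner product of \<open>f' h\<close> with 1 in the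
    reals.\<close>
  then have "f' = (\<lambda>h. h \<bullet> adjoint f' 1)"
    using adjoint_works[of f' _ 1] by (auto simp: inner_commute fun_eq_iff)
  then have "GDERIV f x :> adjoint f' 1"
    using f' by (simp add: gderiv_def)
  then show ?thesis
    by (simp add: gradient_eq)
qed

lemma gradient_Phi:
  fixes f :: "nat \<Rightarrow> 'a::euclidean_space \<Rightarrow> real"
  assumes "\<And>i. i \<in> {1..m} \<Longrightarrow> f i differentiable (at x)" and "\<tau> > 0"
  shows "gradient (Phi m f \<tau>) (x, t) =
    ((\<Sum>i = 1..m. dphi \<tau> (f i x - t) *\<^sub>R gradient (f i) x), 1 - (\<Sum>i = 1..m. dphi \<tau> (f i x - t)))"
proof (rule gradient_eq)
  have f: "((\<lambda>w. f i (fst w) - snd w) has_derivative (\<lambda>h. fst h \<bullet> gradient (f i) x - snd h)) (at (x, t))"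
    if "i \<in> {1..m}" for i
  proof -
    have "(f i has_derivative (\<lambda>h. h \<bullet> gradient (f i) x)) (at (fst (x, t)))"
      using differentiable_GDERIV_gradient[OF assms(1)[OF that]] by (simp add: gderiv_def)
    from has_derivative_compose[OF has_derivative_fst[OF has_derivative_ident] this]
    have "((\<lambda>w. f i (fst w)) has_derivative (\<lambda>h. fst h \<bullet> gradient (f i) x)) (at (x, t))"
      by simp
    then show ?thesis
      by (intro has_derivative_diff has_derivative_snd has_derivative_ident)
  qed
  have p: "((\<lambda>w. phi \<tau> (f i (fst w) - snd w)) has_derivative
      (\<lambda>h. dphi \<tau> (f i x - t) * (fst h \<bullet> gradient (f i) x - snd h))) (at (x, t))"
    if "i \<in> {1..m}" for i
    using has_derivative_compose[OF f[OF that], of "phi \<tau>" "(*) (dphi \<tau> (f i x - t))"]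
      phi_has_derivative[OF assms(2), of "f i x - t"]
    by (simp add: has_field_derivative_def)
  have "((\<lambda>w. snd w + (\<Sum>i = 1..m. phi \<tau> (f i (fst w) - snd w))) has_derivative
      (\<lambda>h. snd h + (\<Sum>i = 1..m. dphi \<tau> (f i x - t) * (fst h \<bullet> gradient (f i) x - snd h)))) (at (x, t))"
    by (intro has_derivative_add has_derivative_sum p has_derivative_snd has_derivative_ident)
  moreover have "(\<lambda>w. snd w + (\<Sum>i = 1..m. phi \<tau> (f i (fst w) - snd w))) = Phi m f \<tau>"
    by (auto simp: Phi_def)
  moreover have "(\<lambda>h. snd h + (\<Sum>i = 1..m. dphi \<tau> (f i x - t) * (fst h \<bullet> gradient (f i) x - snd h))) =
      (\<lambda>h. h \<bullet> ((\<Sum>i = 1..m. dphi \<tau> (f i x - t) *\<^sub>R gradient (f i) x), 1 - (\<Sum>i = 1..m. dphi \<tau> (f i x - t))))"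
    by (auto simp: inner_prod_def inner_sum_right algebra_simps sum_subtractf sum_distrib_left)
  ultimately show "GDERIV (Phi m f \<tau>) (x, t) :>
      ((\<Sum>i = 1..m. dphi \<tau> (f i x - t) *\<^sub>R gradient (f i) x), 1 - (\<Sum>i = 1..m. dphi \<tau> (f i x - t)))"
    by (simp add: gderiv_def)
qed

section \<open>Lower bounds for the Clarke derivative of a maximum\<close>

lemma clarke_dir_deriv_ge:
  assumes "eventually (\<lambda>s. q s \<le> (h (x + s *\<^sub>R d) - h x) / s) (at_right 0)"
    and "(q \<longlongrightarrow> l) (at_right 0)"
  shows "ereal l \<le> clarke_dir_deriv h x d"
  unfolding clarke_dir_deriv_def Limsup_def
proof (rule INF_greatest, clarsimp)
  \<comment> \<open>The Limsup is an infimum, over eventual \<open>P\<close>, of suprema over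
    \<open>P\<close>; each supremum is bounded below separately.\<close>
  fix P assume P: "eventually P (nhds x \<times>\<^sub>F at_right (0::real))"
  let ?S = "SUP p\<in>Collect P. case p of (y, s) \<Rightarrow> ereal ((h (y + s *\<^sub>R d) - h y) / s)"
  \<comment> \<open>The filter \<open>nhds x\<close> admits the base point \<open>x\<close> itself,
    so keeping \<open>y = x\<close> fixed is a legitimate approach and the ordinary one-sided
    quotients enter every supremum.\<close>
  have "filterlim (\<lambda>s. (x, s)) (nhds x \<times>\<^sub>F at_right (0::real)) (at_right 0)"
    by (intro filterlim_Pair tendsto_const filterlim_ident)
  then have "\<forall>\<^sub>F s in at_right (0::real). P (x, s)"
    using P by (simp add: filterlim_iff)
  with assms(1) have "\<forall>\<^sub>F s in at_right (0::real). ereal (q s) \<le> ?S"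
  proof eventually_elim
    case (elim s)
    then show ?case
      by (intro SUP_upper2[of "(x, s)"]) auto
  qed
  moreover have "((\<lambda>s. ereal (q s)) \<longlongrightarrow> ereal l) (at_right 0)"
    using assms(2) by simp
  ultimately show "ereal l \<le> ?S"
    by (intro tendsto_upperbound[where F = "at_right (0::real)"]) auto
qed

lemma GDERIV_directional:
  assumes "GDERIV f x :> D"
  shows "((\<lambda>s. (f (x + s *\<^sub>R d) - f x) / s) \<longlongrightarrow> d \<bullet> D) (at_right 0)"
proof -
  have "((\<lambda>s. x + s *\<^sub>R d) has_derivative (\<lambda>s. s *\<^sub>R d)) (at 0)"
    by (auto intro!: derivative_eq_intros)
  from has_derivative_compose[OF this, of f "\<lambda>h. h \<bullet> D"] assms
  have "((\<lambda>s. f (x + s *\<^sub>R d)) has_real_derivative d \<bullet> D) (at 0)"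
    by (simp add: gderiv_def has_field_derivative_def mult_commute_abs)
  then have "((\<lambda>s. (f (x + s *\<^sub>R d) - f x) / s) \<longlongrightarrow> d \<bullet> D) (at 0)"
    by (simp add: DERIV_def)
  then show ?thesis
    by (rule tendsto_mono[rotated]) (simp add: at_le)
qed

lemma max_fun_ge: "i \<in> {1..m} \<Longrightarrow> f i x \<le> max_fun m f x"
  by (simp add: max_fun_def)

lemma max_fun_attained:
  assumes "1 \<le> m"
  obtains i where "i \<in> {1..m}" "f i x = max_fun m f x"
proof -
  have "max_fun m f x \<in> (\<lambda>i. f i x) ` {1..m}"
    unfolding max_fun_def using assms by (intro Max_in) auto
  then show ?thesis
    using that by auto
qed

text \<open>The maximum dominates an active \<open>f i\<close> and agrees with it at
  \<open>x\<close>, so its forward quotients along \<open>d\<close> dominate those of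
  \<open>f i\<close>. The index may depend on \<open>d\<close>, which avoids constructing convex
  multipliers.\<close>

lemma zero_in_clarke_subdifferential_max_fun:
  assumes "\<And>d. \<exists>i \<in> {1..m}. f i x = max_fun m f x \<and> f i differentiable (at x) \<and> 0 \<le> d \<bullet> gradient (f i) x"
  shows "0 \<in> clarke_subdifferential (max_fun m f) x"
proof -
  have "0 \<le> clarke_dir_deriv (max_fun m f) x d" for d
  proof -
    obtain i where i: "i \<in> {1..m}" "f i x = max_fun m f x" "f i differentiable (at x)"
      and nonneg: "0 \<le> d \<bullet> gradient (f i) x"
      using assms by blast
    have "\<forall>\<^sub>F s in at_right 0. (f i (x + s *\<^sub>R d) - f i x) / s \<le>
        (max_fun m f (x + s *\<^sub>R d) - max_fun m f x) / s"
      using eventually_at_right_less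
      by eventually_elim (use i max_fun_ge[OF i(1)] in \<open>auto intro!: divide_right_mono\<close>)
    then have "ereal (d \<bullet> gradient (f i) x) \<le> clarke_dir_deriv (max_fun m f) x d"
      using GDERIV_directional[OF differentiable_GDERIV_gradient[OF i(3)]] by (rule clarke_dir_deriv_ge)
    with nonneg show ?thesis
      by (metis ereal_less_eq(5) order_trans)
  qed
  then show ?thesis
    by (simp add: clarke_subdifferential_def zero_ereal_def)
qed

section \<open>Limits of the weights\<close>

lemma inactive_weight_tendsto_0:
  assumes "\<And>i. i \<in> I \<Longrightarrow> (\<lambda>k. g i k) \<longlonglongrightarrow> G i" and "finite I"
    and "t \<longlonglongrightarrow> T" and "\<tau> \<longlonglongrightarrow> 0"
    and sum: "(\<lambda>k. \<Sum>i\<in>I. dphi (\<tau> k) (g i k - t k)) \<longlonglongrightarrow> 1"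
    and "i \<in> I" "j \<in> I" "G j < G i"
  shows "(\<lambda>k. dphi (\<tau> k) (g j k - t k)) \<longlonglongrightarrow> 0"
proof (cases "G j < T")
  case True
  have "(\<lambda>k. g j k - t k) \<longlonglongrightarrow> G j - T"
    using assms by (intro tendsto_diff) auto
  from dphi_tendsto[OF this assms(4)] True show ?thesis
    by simp
next
  case False
  \<comment> \<open>This branch includes \<open>G j = T\<close>, where the argument of the weight of
    \<open>j\<close> tends to the kink and \<open>dphi_tendsto\<close> says nothing; only the mass
    taken by \<open>i\<close> forces that weight down.\<close>
  then have "G i > T"
    using assms by simp
  have "(\<lambda>k. g i k - t k) \<longlonglongrightarrow> G i - T"
    using assms by (intro tendsto_diff) auto
  from dphi_tendsto[OF this assms(4)] \<open>G i > T\<close>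
  have "(\<lambda>k. dphi (\<tau> k) (g i k - t k)) \<longlonglongrightarrow> 1"
    by simp
  from tendsto_diff[OF sum this]
  have lim: "(\<lambda>k. (\<Sum>i\<in>I. dphi (\<tau> k) (g i k - t k)) - dphi (\<tau> k) (g i k - t k)) \<longlonglongrightarrow> 0"
    by simp
  \<comment> \<open>All weights are nonnegative, so what remains after removing that of
    \<open>i\<close> still bounds that of \<open>j\<close>.\<close>
  have "dphi (\<tau> k) (g j k - t k) \<le> (\<Sum>i\<in>I. dphi (\<tau> k) (g i k - t k)) - dphi (\<tau> k) (g i k - t k)" for k
  proof -
    have "i \<noteq> j"
      using assms by auto
    then have "(\<Sum>l\<in>{i, j}. dphi (\<tau> k) (g l k - t k)) \<le> (\<Sum>l\<in>I. dphi (\<tau> k) (g l k - t k))"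
      using assms by (intro sum_mono2) (auto simp: dphi_bounds)
    with \<open>i \<noteq> j\<close> show ?thesis
      by simp
  qed
  then show ?thesis
    by (intro tendsto_sandwich[OF _ _ tendsto_const lim]) (auto simp: dphi_bounds)
qed

text \<open>If \<open>a\<close> were negative on all of \<open>A\<close>, it would lie below a
  negative constant there; since the mass concentrates on \<open>A\<close>, the weighted sum would
  stay away from 0. Individual weights on \<open>A\<close> need not converge.\<close>

lemma weighted_sum_limit_nonneg:
  fixes a :: "'i \<Rightarrow> real"
  assumes "finite I"
    and nonneg: "\<And>i k. i \<in> I \<Longrightarrow> 0 \<le> w i k"
    and "(\<lambda>k. \<Sum>i\<in>I. w i k) \<longlonglongrightarrow> 1"
    and "(\<lambda>k. \<Sum>i\<in>I. w i k * a i) \<longlonglongrightarrow> 0"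
    and out: "\<And>i. i \<in> I - A \<Longrightarrow> (\<lambda>k. w i k) \<longlonglongrightarrow> 0"
    and "A \<subseteq> I"
  shows "\<exists>i\<in>A. 0 \<le> a i"
proof (rule ccontr)
  assume "\<not> (\<exists>i\<in>A. 0 \<le> a i)"
  then have neg: "a i < 0" if "i \<in> A" for i
    using that by force
  have fin: "finite A"
    using assms(1) \<open>A \<subseteq> I\<close> by (rule rev_finite_subset)
  have split: "(\<Sum>i\<in>A. h i) = (\<Sum>i\<in>I. h i) - (\<Sum>i\<in>I - A. h i)" for h :: "'i \<Rightarrow> real"
    using sum_diff[OF assms(1) \<open>A \<subseteq> I\<close>, of h] by simp
  have "(\<lambda>k. \<Sum>i\<in>I - A. w i k) \<longlonglongrightarrow> (\<Sum>i\<in>I - A. 0)"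
    by (intro tendsto_sum out)
  from tendsto_diff[OF assms(3) this] have sumA: "(\<lambda>k. \<Sum>i\<in>A. w i k) \<longlonglongrightarrow> 1"
    by (simp add: split)
  have "(\<lambda>k. \<Sum>i\<in>I - A. w i k * a i) \<longlonglongrightarrow> (\<Sum>i\<in>I - A. 0 * a i)"
    by (intro tendsto_sum tendsto_mult_right out)
  from tendsto_diff[OF assms(4) this] have wA: "(\<lambda>k. \<Sum>i\<in>A. w i k * a i) \<longlonglongrightarrow> 0"
    by (simp add: split)
  \<comment> \<open>Over an empty \<open>A\<close> the sum would be constantly 0 and could not tend
    to 1. This makes the maximum \<open>c\<close> meaningful.\<close>
  have "A \<noteq> {}"
    using sumA by (auto simp: LIMSEQ_const_iff)
  define c where "c = Max (a ` A)"
  have "c < 0"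
    unfolding c_def using fin \<open>A \<noteq> {}\<close> neg by simp
  have "(\<Sum>i\<in>A. w i k * a i) \<le> (\<Sum>i\<in>A. w i k) * c" for k
    unfolding sum_distrib_right
    using fin nonneg \<open>A \<subseteq> I\<close> by (intro sum_mono mult_left_mono) (auto simp: c_def)
  then have "0 \<le> 1 * c"
    by (intro LIMSEQ_le[OF wA tendsto_mult_right[OF sumA]]) auto
  with \<open>c < 0\<close> show False
    by simp
qed

section \<open>Passage to the limit along a convergent subsequence of terminal points\<close>

theorem theorem8p4:
  fixes m :: nat
    and f :: "nat \<Rightarrow> real ^ 'n \<Rightarrow> real"
    and \<tau>\<^sub>0 \<tau>\<^sub>f\<^sub>a\<^sub>c :: real
    and \<epsilon> :: "nat \<Rightarrow> real"
    and x\<^sub>0 :: "real ^ 'n"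
    and z :: "nat \<Rightarrow> (real ^ 'n) \<times> real"
    and x' :: "real ^ 'n" and t' :: real
  assumes "1 \<le> m"
    and "\<And>i. i \<in> {1..m} \<Longrightarrow> cont_differentiable (f i)"
    and "0 < \<tau>\<^sub>0" and "0 < \<tau>\<^sub>f\<^sub>a\<^sub>c" and "\<tau>\<^sub>f\<^sub>a\<^sub>c < 1"
    and "compact {w. Phi m f \<tau>\<^sub>0 w \<le> Phi m f \<tau>\<^sub>0 (x\<^sub>0, max_fun m f x\<^sub>0)}"
    and "\<And>k. norm (gradient (Phi m f (\<tau>\<^sub>0 * \<tau>\<^sub>f\<^sub>a\<^sub>c ^ k)) (z k)) \<le> \<epsilon> k"
    and "decseq \<epsilon>" and "\<epsilon> \<longlonglongrightarrow> 0"
    and "\<exists>r. strict_mono r \<and> (z \<circ> r) \<longlonglongrightarrow> (x', t')"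
  shows "0 \<in> clarke_subdifferential (max_fun m f) x'"
proof -
  define \<tau> where "\<tau> k = \<tau>\<^sub>0 * \<tau>\<^sub>f\<^sub>a\<^sub>c ^ k" for k
  have \<tau>_pos: "\<tau> k > 0" for k
    using assms(3,4) by (simp add: \<tau>_def)
  have diff: "f i differentiable (at x)" if "i \<in> {1..m}" for i x
    using assms(2)[OF that] by (simp add: cont_differentiable_def)
  have f_cont: "isCont (f i) x" if "i \<in> {1..m}" for i x
    using diff[OF that] by (rule differentiable_imp_continuous_within)
  have grad_cont: "isCont (gradient (f i)) x" if "i \<in> {1..m}" for i x
    using assms(2)[OF that] by (simp add: cont_differentiable_def continuous_on_eq_continuous_at)
  obtain r where r: "strict_mono r" and z_lim: "(z \<circ> r) \<longlonglongrightarrow> (x', t')"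
    using assms(10) by blast
  define x where "x k = fst (z (r k))" for k
  define t where "t k = snd (z (r k))" for k
  have x_lim: "x \<longlonglongrightarrow> x'" and t_lim: "t \<longlonglongrightarrow> t'"
    using tendsto_fst[OF z_lim] tendsto_snd[OF z_lim] by (simp_all add: x_def[abs_def] t_def[abs_def])
  have "(\<lambda>k. \<tau>\<^sub>0 * \<tau>\<^sub>f\<^sub>a\<^sub>c ^ k) \<longlonglongrightarrow> \<tau>\<^sub>0 * 0"
    using assms(4,5) by (intro tendsto_mult_left LIMSEQ_power_zero) auto
  then have "\<tau> \<longlonglongrightarrow> 0"
    by (simp add: \<tau>_def[abs_def])
  then have \<tau>_lim: "(\<lambda>k. \<tau> (r k)) \<longlonglongrightarrow> 0"
    using LIMSEQ_subseq_LIMSEQ[OF _ r] by (auto simp: o_def)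
  have \<epsilon>_lim: "(\<lambda>k. \<epsilon> (r k)) \<longlonglongrightarrow> 0"
    using LIMSEQ_subseq_LIMSEQ[OF assms(9) r] by (simp add: o_def)
  define w where "w i k = dphi (\<tau> (r k)) (f i (x k) - t k)" for i k
  have "(\<lambda>k. gradient (Phi m f (\<tau> (r k))) (z (r k))) \<longlonglongrightarrow> 0"
    by (rule Lim_null_comparison[OF _ \<epsilon>_lim]) (simp add: assms(7) \<tau>_def)
  moreover have "gradient (Phi m f (\<tau> (r k))) (z (r k)) =
      ((\<Sum>i = 1..m. w i k *\<^sub>R gradient (f i) (x k)), 1 - (\<Sum>i = 1..m. w i k))" for k
    using gradient_Phi[of m f "x k" "\<tau> (r k)" "t k"] diff \<tau>_pos by (simp add: w_def x_def t_def)
  ultimately have grad_lim: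
    "(\<lambda>k. ((\<Sum>i = 1..m. w i k *\<^sub>R gradient (f i) (x k)), 1 - (\<Sum>i = 1..m. w i k))) \<longlonglongrightarrow> 0"
    by simp
  \<comment> \<open>The last component of the gradient is the defect of the total weight from 1; the
    double subtraction isolates that weight.\<close>
  have "(\<lambda>k. 1 - (1 - (\<Sum>i = 1..m. w i k))) \<longlonglongrightarrow> 1 - 0"
    using tendsto_snd[OF grad_lim] by (intro tendsto_diff tendsto_const) simp
  then have w_sum: "(\<lambda>k. \<Sum>i = 1..m. w i k) \<longlonglongrightarrow> 1"
    by simp
  have w_grad: "(\<lambda>k. \<Sum>i = 1..m. w i k *\<^sub>R gradient (f i) (x k)) \<longlonglongrightarrow> 0"
    using tendsto_fst[OF grad_lim] by simp
  \<comment> \<open>Continuity of the gradients allows \<open>x k\<close> to be replaced by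
    \<open>x'\<close>: weights in [0, 1] cannot enlarge the vanishing difference, whether or not
    they converge.\<close>
  have w_diff: "(\<lambda>k. w i k *\<^sub>R (gradient (f i) x' - gradient (f i) (x k))) \<longlonglongrightarrow> 0" if "i \<in> {1..m}" for i
  proof (rule Lim_null_comparison)
    have "(\<lambda>k. gradient (f i) x' - gradient (f i) (x k)) \<longlonglongrightarrow> gradient (f i) x' - gradient (f i) x'"
      by (intro tendsto_intros isCont_tendsto_compose[OF grad_cont[OF that]] x_lim)
    then show "(\<lambda>k. norm (gradient (f i) x' - gradient (f i) (x k))) \<longlonglongrightarrow> 0"
      by (simp add: tendsto_norm_zero)
  qed (simp add: w_def dphi_bounds mult_left_le_one_le)
  have "(\<lambda>k. (\<Sum>i = 1..m. w i k *\<^sub>R gradient (f i) (x k)) +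
      (\<Sum>i = 1..m. w i k *\<^sub>R (gradient (f i) x' - gradient (f i) (x k)))) \<longlonglongrightarrow> 0 + (\<Sum>i = 1..m. 0)"
    by (intro tendsto_add w_grad tendsto_sum w_diff)
  then have w_grad': "(\<lambda>k. \<Sum>i = 1..m. w i k *\<^sub>R gradient (f i) x') \<longlonglongrightarrow> 0"
    by (simp add: scaleR_diff_right sum_subtractf)
  define A where "A = {i \<in> {1..m}. f i x' = max_fun m f x'}"
  \<comment> \<open>A single active index serves as the strictly larger competitor for every
    inactive \<open>j\<close>.\<close>
  obtain i\<^sub>0 where i\<^sub>0: "i\<^sub>0 \<in> {1..m}" "f i\<^sub>0 x' = max_fun m f x'"
    using max_fun_attained[OF assms(1)] .
  have inactive: "w j \<longlonglongrightarrow> 0" if "j \<in> {1..m} - A" for j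
    unfolding w_def
  proof (rule inactive_weight_tendsto_0[where I = "{1..m}" and i = i\<^sub>0 and G = "\<lambda>i. f i x'"])
    show "(\<lambda>k. f i (x k)) \<longlonglongrightarrow> f i x'" if "i \<in> {1..m}" for i
      by (rule isCont_tendsto_compose[OF f_cont[OF that] x_lim])
    show "f j x' < f i\<^sub>0 x'"
      using that i\<^sub>0(2) max_fun_ge[of j m f x'] by (auto simp: A_def)
  qed (use w_sum t_lim \<tau>_lim i\<^sub>0 that in \<open>auto simp: w_def\<close>)
  show ?thesis
  proof (rule zero_in_clarke_subdifferential_max_fun)
    fix d
    \<comment> \<open>Pairing with \<open>d\<close> reduces the vector limit to the scalar lemma
      with \<open>a i = d \<bullet> gradient (f i) x'\<close>.\<close>
    have "(\<lambda>k. d \<bullet> (\<Sum>i = 1..m. w i k *\<^sub>R gradient (f i) x')) \<longlonglongrightarrow> d \<bullet> 0"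
      by (intro tendsto_inner tendsto_const w_grad')
    then have "(\<lambda>k. \<Sum>i = 1..m. w i k * (d \<bullet> gradient (f i) x')) \<longlonglongrightarrow> 0"
      by (simp add: inner_sum_right)
    then have "\<exists>i\<in>A. 0 \<le> d \<bullet> gradient (f i) x'"
      by (intro weighted_sum_limit_nonneg[OF _ _ w_sum _ inactive])
        (auto simp: w_def dphi_bounds A_def)
    then show "\<exists>i\<in>{1..m}. f i x' = max_fun m f x' \<and> f i differentiable (at x') \<and> 0 \<le> d \<bullet> gradient (f i) x'"
      using diff by (auto simp: A_def)
  qed
qed

end
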